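(* Let $X,Y$ be compacta. The set $\mathcal{CSA}\mathrm{mb}(X,Y)$ of all strict ambiguous representations between $X$ and $Y$, ordered by inclusion (with join given by union) and equipped with the subspace topology inherited from the Vietoris topology on $\exp(\exp X\times\exp Y)$, is a compact Lawson upper semilattice.
   Context: A compactum is a (not necessarily metrizable) compact Hausdorff space. For a compactum $K$, $\exp K$ is the set of all non-empty closed subsets of $K$ with the Vietoris topology, whose base consists of the sets $\langle U_1,\dots,U_n\rangle=\{F\in\exp K\mid F\subset U_1\cup\dots\cup U_n,\ F\cap U_i\neq\varnothing,\ i=1,\dots,n\}$ for open $U_1,\dots,U_n\subset K$; it is again a compactum. A strict ambiguous representation between compacta $X$ and $Y$ is a subset $R\subset\exp X\times\exp Y$ that is closed, contains $\exp X\times\{Y\}$, and such that $(A,B)\in R$, $A'\in\exp X$, $B'\in\exp Y$, $A'\subset A$, $B'\supset B$ imply $(A',B')\in R$. A topological upper semilattice (a topological space with a partial order having continuous pairwise joins) is called Lawson if each point possesses a local base consisting of upper subsemilattices. All topological semilattices are assumed Hausdorff. *)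

theory Defs
  imports "HOL-Analysis.Analysis" "HOL-Algebra.Lattice"
begin

definition compactum :: "'a topology \<Rightarrow> bool" where
  "compactum K \<longleftrightarrow> compact_space K \<and> Hausdorff_space K"

section \<open>The Vietoris hyperspace\<close>

definition hyperset :: "'a topology \<Rightarrow> 'a set set" where
  "hyperset K = {F. closedin K F \<and> F \<noteq> {}}"

text \<open>The finite family \<open>\<U>\<close> plays the role of the list \<open>U\<^sub>1, \<dots>, U\<^sub>n\<close>;
  order and repetitions do not affect the resulting set.\<close>

definition vietoris_box :: "'a topology \<Rightarrow> 'a set set \<Rightarrow> 'a set set" where
  "vietoris_box K \<U> = {F \<in> hyperset K. F \<subseteq> \<Union>\<U> \<and> (\<forall>U\<in>\<U>. F \<inter> U \<noteq> {})}"

definition vietoris_basic :: "'a topology \<Rightarrow> 'a set set \<Rightarrow> bool" where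
  "vietoris_basic K W \<longleftrightarrow> (\<exists>\<U>. finite \<U> \<and> (\<forall>U\<in>\<U>. openin K U) \<and> W = vietoris_box K \<U>)"

definition vietoris :: "'a topology \<Rightarrow> 'a set topology" where
  "vietoris K = topology (arbitrary union_of vietoris_basic K)"

lemma vietoris_basic_Int:
  assumes "vietoris_basic K S" "vietoris_basic K T"
  shows "vietoris_basic K (S \<inter> T)"
proof -
  obtain \<U> where U: "finite \<U>" "\<forall>U\<in>\<U>. openin K U" "S = vietoris_box K \<U>"
    using assms(1) unfolding vietoris_basic_def by blast
  obtain \<V> where V: "finite \<V>" "\<forall>V\<in>\<V>. openin K V" "T = vietoris_box K \<V>"
    using assms(2) unfolding vietoris_basic_def by blast
  define \<W> where "\<W> = (\<lambda>U. U \<inter> \<Union>\<V>) ` \<U> \<union> (\<lambda>V. V \<inter> \<Union>\<U>) ` \<V>"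
  have "finite \<W>"
    using U V by (simp add: \<W>_def)
  moreover have "\<forall>W\<in>\<W>. openin K W"
    using U V by (auto simp: \<W>_def intro!: openin_Int openin_Union)
  moreover have "S \<inter> T = vietoris_box K \<W>"
  proof -
    have un: "\<Union>\<W> = \<Union>\<U> \<inter> \<Union>\<V>"
      by (auto simp: \<W>_def)
    have "(\<forall>U\<in>\<U>. F \<inter> U \<noteq> {}) \<and> (\<forall>V\<in>\<V>. F \<inter> V \<noteq> {}) \<longleftrightarrow> (\<forall>W\<in>\<W>. F \<inter> W \<noteq> {})"
      if "F \<subseteq> \<Union>\<U>" "F \<subseteq> \<Union>\<V>" for F
    proof -
      have "F \<inter> (U \<inter> \<Union>\<V>) = F \<inter> U" "F \<inter> (U \<inter> \<Union>\<U>) = F \<inter> U" for U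
        using that by blast+
      then show ?thesis
        unfolding \<W>_def ball_Un ball_simps by (simp only:)
    qed
    then have eq: "F \<in> vietoris_box K \<U> \<inter> vietoris_box K \<V> \<longleftrightarrow> F \<in> vietoris_box K \<W>" for F
      unfolding vietoris_box_def Int_iff mem_Collect_eq un le_inf_iff by meson
    show ?thesis
      unfolding U(3) V(3) by (rule Set.set_eqI) (rule eq)
  qed
  ultimately show ?thesis
    unfolding vietoris_basic_def by (intro exI[of _ \<W>] conjI)
qed

lemma openin_vietoris: "openin (vietoris K) = arbitrary union_of vietoris_basic K"
  unfolding vietoris_def
  by (intro topology_inverse' istopology_base vietoris_basic_Int)

lemma topspace_vietoris [simp]: "topspace (vietoris K) = hyperset K"
proof
  show "topspace (vietoris K) \<subseteq> hyperset K"
  proof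
    fix F assume "F \<in> topspace (vietoris K)"
    moreover obtain \<B> where "\<B> \<subseteq> Collect (vietoris_basic K)" "\<Union>\<B> = topspace (vietoris K)"
      using openin_topspace[of "vietoris K"]
      unfolding openin_vietoris union_of_def by (elim exE conjE)
    ultimately obtain W where "vietoris_basic K W" "F \<in> W"
      by blast
    then show "F \<in> hyperset K"
      by (auto simp: vietoris_basic_def vietoris_box_def)
  qed
next
  have "vietoris_box K {topspace K} = hyperset K"
    by (auto simp: vietoris_box_def hyperset_def dest: closedin_subset)
  moreover have "vietoris_basic K (vietoris_box K {topspace K})"
    unfolding vietoris_basic_def by (rule exI[of _ "{topspace K}"]) auto
  ultimately have "openin (vietoris K) (hyperset K)"
    by (simp add: openin_vietoris arbitrary_union_of_inc)
  then show "hyperset K \<subseteq> topspace (vietoris K)"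
    by (rule openin_subset)
qed

section \<open>Strict ambiguous representations\<close>

definition strict_ambrep :: "'a topology \<Rightarrow> 'b topology \<Rightarrow> ('a set \<times> 'b set) set \<Rightarrow> bool" where
  "strict_ambrep X Y R \<longleftrightarrow>
     closedin (prod_topology (vietoris X) (vietoris Y)) R \<and>
     hyperset X \<times> {topspace Y} \<subseteq> R \<and>
     (\<forall>A B. \<forall>A'\<in>hyperset X. \<forall>B'\<in>hyperset Y.
        (A, B) \<in> R \<and> A' \<subseteq> A \<and> B \<subseteq> B' \<longrightarrow> (A', B') \<in> R)"

text \<open>The set of strict ambiguous representations is regarded as a subset of
  \<open>exp (exp X \<times> exp Y)\<close>. Membership in the hyperspace adds nothing to
  \<open>strict_ambrep\<close> unless \<open>X\<close> is empty, see \<open>csamb_eq\<close> below.\<close>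

definition csamb :: "'a topology \<Rightarrow> 'b topology \<Rightarrow> ('a set \<times> 'b set) set set" where
  "csamb X Y = {R \<in> hyperset (prod_topology (vietoris X) (vietoris Y)). strict_ambrep X Y R}"

definition csamb_order :: "'a topology \<Rightarrow> 'b topology \<Rightarrow> ('a set \<times> 'b set) set gorder" where
  "csamb_order X Y = \<lparr>carrier = csamb X Y, eq = (=), le = (\<subseteq>)\<rparr>"

definition csamb_topology :: "'a topology \<Rightarrow> 'b topology \<Rightarrow> ('a set \<times> 'b set) set topology" where
  "csamb_topology X Y =
     subtopology (vietoris (prod_topology (vietoris X) (vietoris Y))) (csamb X Y)"

lemma csamb_eq:
  assumes "topspace X \<noteq> {}"
  shows "csamb X Y = {R. strict_ambrep X Y R}"
proof -
  have "topspace X \<in> hyperset X"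
    using assms unfolding hyperset_def by blast
  then have "R \<noteq> {}" if "strict_ambrep X Y R" for R
    using that unfolding strict_ambrep_def by blast
  then show ?thesis
    unfolding csamb_def hyperset_def[of "prod_topology _ _"] strict_ambrep_def by auto
qed

lemma topspace_csamb_topology [simp]: "topspace (csamb_topology X Y) = csamb X Y"
  by (auto simp: csamb_topology_def csamb_def)

section \<open>Lawson upper semilattices\<close>

definition topological_upper_semilattice ::
    "('a, 'm) gorder_scheme \<Rightarrow> 'a topology \<Rightarrow> bool" where
  "topological_upper_semilattice L T \<longleftrightarrow>
     upper_semilattice L \<and> carrier L = topspace T \<and> Hausdorff_space T \<and>
     continuous_map (prod_topology T T) T (\<lambda>(x, y). x \<squnion>\<^bsub>L\<^esub> y)"

definition upper_subsemilattice :: "('a, 'm) gorder_scheme \<Rightarrow> 'a set \<Rightarrow> bool" where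
  "upper_subsemilattice L S \<longleftrightarrow> S \<subseteq> carrier L \<and> (\<forall>x\<in>S. \<forall>y\<in>S. x \<squnion>\<^bsub>L\<^esub> y \<in> S)"

text \<open>Members of a local base are open sets.\<close>

definition Lawson_upper_semilattice :: "('a, 'm) gorder_scheme \<Rightarrow> 'a topology \<Rightarrow> bool" where
  "Lawson_upper_semilattice L T \<longleftrightarrow>
     topological_upper_semilattice L T \<and>
     (\<forall>x\<in>topspace T.
        neighbourhood_base_at x (\<lambda>V. openin T V \<and> upper_subsemilattice L V) T)"

end

(* A box of the Vietoris topology is closed under unions, so boxes give a local base of
   subsemilattices, and union is continuous on exp Z for Z = exp X x exp Y. As exp Z is a
   compactum, it remains to see that the representations form a closed subset. If monotonicity
   fails for R at (A, B) in R and (A', B') not in R, separate (A', B') from R by disjoint open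
   sets V and N. The pairs dominating some element of V form an open set W containing (A, B),
   and every S that lies inside N and meets W violates monotonicity as well. *)

theory Submission
  imports Defs
begin

section \<open>The Vietoris topology\<close>

text \<open>Together with \<open>vietoris_hit\<close> this splits a box into its containment
  condition and its intersection conditions. For open \<open>U\<close> the two kinds of sets form
  the classical subbase of the Vietoris topology.\<close>

definition vietoris_sub :: "'a topology \<Rightarrow> 'a set \<Rightarrow> 'a set set" where
  "vietoris_sub K U = {F \<in> hyperset K. F \<subseteq> U}"

definition vietoris_hit :: "'a topology \<Rightarrow> 'a set \<Rightarrow> 'a set set" where
  "vietoris_hit K U = {F \<in> hyperset K. F \<inter> U \<noteq> {}}"

lemma openin_vietoris_box:
  assumes "finite \<U>" "\<And>U. U \<in> \<U> \<Longrightarrow> openin K U"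
  shows "openin (vietoris K) (vietoris_box K \<U>)"
  unfolding openin_vietoris
  by (rule arbitrary_union_of_inc) (use assms in \<open>auto simp: vietoris_basic_def\<close>)

lemma openin_vietorisE:
  assumes "openin (vietoris K) W" "F \<in> W"
  obtains \<U> where "finite \<U>" "\<And>U. U \<in> \<U> \<Longrightarrow> openin K U"
    "F \<in> vietoris_box K \<U>" "vietoris_box K \<U> \<subseteq> W"
proof -
  obtain B where "vietoris_basic K B" "F \<in> B" "B \<subseteq> W"
    using assms unfolding openin_vietoris arbitrary_union_of_alt by metis
  then show ?thesis
    using that unfolding vietoris_basic_def by metis
qed

lemma vietoris_box_eq:
  "vietoris_box K \<U> = vietoris_sub K (\<Union>\<U>) \<inter> (\<Inter>U\<in>\<U>. vietoris_hit K U)"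
  by (auto simp: vietoris_box_def vietoris_sub_def vietoris_hit_def)

lemma openin_vietoris_sub:
  assumes "openin K U"
  shows "openin (vietoris K) (vietoris_sub K U)"
proof -
  have "vietoris_sub K U = vietoris_box K {U}"
    by (auto simp: vietoris_box_def vietoris_sub_def hyperset_def)
  then show ?thesis
    using openin_vietoris_box[of "{U}" K] assms by simp
qed

lemma openin_vietoris_hit:
  assumes "openin K U"
  shows "openin (vietoris K) (vietoris_hit K U)"
proof -
  have "vietoris_hit K U = vietoris_box K {U, topspace K}"
    by (auto simp: vietoris_box_def vietoris_hit_def hyperset_def dest: closedin_subset)
  then show ?thesis
    using openin_vietoris_box[of "{U, topspace K}" K] assms by auto
qed

text \<open>A box is one \<open>vietoris_sub\<close> set cut by finitely many
  \<open>vietoris_hit\<close> sets, so checking preimages of these subbasic sets suffices.\<close>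

lemma continuous_map_into_vietoris:
  assumes "f \<in> topspace X \<rightarrow> hyperset K"
    and sub: "\<And>U. openin K U \<Longrightarrow> openin X {x \<in> topspace X. f x \<in> vietoris_sub K U}"
    and hit: "\<And>U. openin K U \<Longrightarrow> openin X {x \<in> topspace X. f x \<in> vietoris_hit K U}"
  shows "continuous_map X (vietoris K) f"
proof (rule continuous_map_into_topology_base[OF openin_vietoris])
  show "f x \<in> topspace (vietoris K)" if "x \<in> topspace X" for x
    using assms(1) that by auto
next
  fix W assume "vietoris_basic K W"
  then obtain \<U> where \<U>: "finite \<U>" "\<And>U. U \<in> \<U> \<Longrightarrow> openin K U" "W = vietoris_box K \<U>"
    unfolding vietoris_basic_def by blast
  \<comment> \<open>The factor \<open>topspace X\<close> matters when \<open>\<U>\<close> is empty: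
    the intersection over \<open>\<U>\<close> is then the universal set, which need not be
    open.\<close>
  have "{x \<in> topspace X. f x \<in> W} = {x \<in> topspace X. f x \<in> vietoris_sub K (\<Union>\<U>)}
      \<inter> (topspace X \<inter> (\<Inter>U\<in>\<U>. {x \<in> topspace X. f x \<in> vietoris_hit K U}))"
    unfolding \<U>(3) vietoris_box_eq by auto
  moreover have "openin X (topspace X \<inter> (\<Inter>U\<in>\<U>. {x \<in> topspace X. f x \<in> vietoris_hit K U}))"
    using \<U> hit by (cases "\<U> = {}") (auto intro!: openin_Int openin_INT2)
  ultimately show "openin X {x \<in> topspace X. f x \<in> W}"
    using sub[of "\<Union>\<U>"] \<U> by (simp add: openin_Int openin_Union)
qed

section \<open>The hyperspace of a compactum is a compactum\<close>

text \<open>By Alexander's lemma only subbasic covers matter. Let \<open>F\<close> be what remains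
  of \<open>K\<close> after removing every open \<open>V\<close> whose hit set is in the cover. If
  non-empty, \<open>F\<close> is itself a point of the hyperspace, and no hit set of the cover
  contains it, so some \<open>vietoris_sub K U\<close> in the cover does. Then \<open>U\<close> and
  the sets \<open>V\<close> cover \<open>K\<close>, and compactness of \<open>K\<close>
  applies.\<close>

lemma compact_space_vietoris:
  assumes "compact_space K"
  shows "compact_space (vietoris K)"
proof -
  define \<B> where "\<B> = vietoris_sub K ` Collect (openin K) \<union> vietoris_hit K ` Collect (openin K)"
  have \<B>_open: "openin (vietoris K) B" if "B \<in> \<B>" for B
    using that openin_vietoris_sub openin_vietoris_hit by (auto simp: \<B>_def)
  have "vietoris_sub K (topspace K) = hyperset K"
    by (auto simp: vietoris_sub_def hyperset_def dest: closedin_subset)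
  then have "hyperset K \<in> \<B>"
    by (auto simp: \<B>_def)
  then have Un_\<B>: "\<Union>\<B> = hyperset K"
    unfolding \<B>_def by (auto simp: vietoris_sub_def vietoris_hit_def)
  show ?thesis
  proof (rule Alexander_subbase)
    show "topology (arbitrary union_of (finite intersection_of (\<lambda>x. x \<in> \<B>) relative_to \<Union>\<B>))
        = vietoris K"
    proof (rule topology_base_unique)
      fix S assume "(finite intersection_of (\<lambda>x. x \<in> \<B>) relative_to \<Union>\<B>) S"
      then obtain \<T> where \<T>: "finite \<T>" "\<T> \<subseteq> \<B>" "S = hyperset K \<inter> \<Inter>\<T>"
        unfolding relative_to_def intersection_of_def Un_\<B> by blast
      then have "S = \<Inter>(insert (hyperset K) \<T>)"
        by simp
      then show "openin (vietoris K) S"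
        using \<T> \<B>_open \<open>hyperset K \<in> \<B>\<close> by (metis finite.insertI insert_not_empty
            insert_subset openin_Inter subset_eq)
    next
      fix W F assume "openin (vietoris K) W" "F \<in> W"
      then obtain \<U> where \<U>: "finite \<U>" "\<And>U. U \<in> \<U> \<Longrightarrow> openin K U"
        "F \<in> vietoris_box K \<U>" "vietoris_box K \<U> \<subseteq> W"
        by (rule openin_vietorisE) blast
      have "vietoris_sub K (\<Union>\<U>) \<in> \<B>" "vietoris_hit K ` \<U> \<subseteq> \<B>"
        using \<U> by (auto simp: \<B>_def)
      then have "(finite intersection_of (\<lambda>x. x \<in> \<B>))
          (\<Inter>(insert (vietoris_sub K (\<Union>\<U>)) (vietoris_hit K ` \<U>)))"
        unfolding intersection_of_def using \<open>finite \<U>\<close>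
        by (intro exI[of _ "insert (vietoris_sub K (\<Union>\<U>)) (vietoris_hit K ` \<U>)"] conjI) auto
      then have "(finite intersection_of (\<lambda>x. x \<in> \<B>) relative_to \<Union>\<B>) 
          (\<Union>\<B> \<inter> vietoris_box K \<U>)"
        unfolding relative_to_def by (auto simp: vietoris_box_eq)
      moreover have "\<Union>\<B> \<inter> vietoris_box K \<U> = vietoris_box K \<U>"
        unfolding Un_\<B> by (auto simp: vietoris_box_def)
      ultimately show "\<exists>B. (finite intersection_of (\<lambda>x. x \<in> \<B>) relative_to \<Union>\<B>) B \<and> F \<in> B \<and> B \<subseteq> W"
        using \<U> by metis
    qed
  next
    fix \<C> assume \<C>: "\<C> \<subseteq> \<B>" "\<Union>\<C> = topspace (vietoris K)"
    define \<V> where "\<V> = {V. openin K V \<and> vietoris_hit K V \<in> \<C>}"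
    \<comment> \<open>The hit sets of \<open>\<W>\<close> take care of every member that meets
      \<open>\<Union>\<W>\<close>, so \<open>\<S>\<close> only has to catch those that miss
      it.\<close>
    have core: "\<exists>\<C>'. finite \<C>' \<and> \<C>' \<subseteq> \<C> \<and> \<Union>\<C>' = topspace (vietoris K)"
      if \<W>: "finite \<W>" "\<W> \<subseteq> \<V>" "finite \<S>" "\<S> \<subseteq> \<C>"
        and cov: "\<And>G. G \<in> hyperset K \<Longrightarrow> G \<inter> \<Union>\<W> = {} \<Longrightarrow> G \<in> \<Union>\<S>" for \<W> \<S>
    proof (intro exI conjI)
      show "finite (\<S> \<union> vietoris_hit K ` \<W>)"
        using \<W> by blast
      show sub: "\<S> \<union> vietoris_hit K ` \<W> \<subseteq> \<C>"
        using \<W> by (auto simp: \<V>_def)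
      have "hyperset K \<subseteq> \<Union>(\<S> \<union> vietoris_hit K ` \<W>)"
        using cov by (fastforce simp: vietoris_hit_def)
      then show "\<Union>(\<S> \<union> vietoris_hit K ` \<W>) = topspace (vietoris K)"
        using Union_mono[OF sub] \<C>(2) by (simp add: subset_antisym)
    qed
    define F where "F = topspace K - \<Union>\<V>"
    have clF: "closedin K F"
      unfolding F_def by (intro closedin_diff) (auto simp: \<V>_def)
    show "\<exists>\<C>'. finite \<C>' \<and> \<C>' \<subseteq> \<C> \<and> \<Union>\<C>' = topspace (vietoris K)"
    \<comment> \<open>The empty set is not a point of the hyperspace. In that case, however, the
      sets in \<open>\<V>\<close> already cover \<open>K\<close>, and finitely many hit sets
      suffice.\<close>
    proof (cases "F = {}")
      case True
      then have "topspace K \<subseteq> \<Union>\<V>"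
        by (auto simp: F_def)
      then obtain \<W> where \<W>: "finite \<W>" "\<W> \<subseteq> \<V>" "topspace K \<subseteq> \<Union>\<W>"
        using assms unfolding compact_space_alt by (metis (no_types, lifting) \<V>_def mem_Collect_eq)
      show ?thesis
      proof (rule core[of \<W> "{}"])
        show "G \<in> \<Union>{}" if "G \<in> hyperset K" "G \<inter> \<Union>\<W> = {}" for G
        proof -
          have "G \<noteq> {}" "G \<subseteq> topspace K"
            using that closedin_subset[of K G] by (simp_all add: hyperset_def)
          then have False
            using that(2) \<W>(3) by blast
          then show ?thesis ..
        qed
      qed (use \<W> in auto)
    next
      case False
      then have "F \<in> hyperset K"
        using clF by (simp add: hyperset_def)
      then obtain C where C: "C \<in> \<C>" "F \<in> C"
        using \<C>(2) by auto
      have "F \<notin> vietoris_hit K V" if "V \<in> \<V>" for V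
        using that by (auto simp: F_def vietoris_hit_def)
      then obtain U where U: "openin K U" "C = vietoris_sub K U"
        using C \<C>(1) unfolding \<B>_def \<V>_def by blast
      have "F \<subseteq> U"
        using C U by (simp add: vietoris_sub_def)
      then have "topspace K \<subseteq> \<Union>(insert U \<V>)"
        by (auto simp: F_def)
      moreover have "\<forall>V \<in> insert U \<V>. openin K V"
        using U by (auto simp: \<V>_def)
      ultimately obtain \<F> where \<F>: "finite \<F>" "\<F> \<subseteq> insert U \<V>" "topspace K \<subseteq> \<Union>\<F>"
        using assms unfolding compact_space_alt by meson
      show ?thesis
      \<comment> \<open>A member that misses all chosen sets from \<open>\<V>\<close> can only be
        covered by \<open>U\<close>, hence lies in \<open>C\<close>.\<close>
      proof (rule core[of "\<F> \<inter> \<V>" "{C}"])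
        show "G \<in> \<Union>{C}" if G: "G \<in> hyperset K" "G \<inter> \<Union>(\<F> \<inter> \<V>) = {}" for G
        proof -
          have "G \<subseteq> topspace K"
            using G(1) closedin_subset[of K G] by (simp add: hyperset_def)
          have "G \<subseteq> U"
          proof
            fix x assume "x \<in> G"
            then obtain V where "V \<in> \<F>" "x \<in> V"
              using \<open>G \<subseteq> topspace K\<close> \<F>(3) by blast
            then show "x \<in> U"
              using \<open>x \<in> G\<close> G(2) \<F>(2) by (cases "V = U") auto
          qed
          then show ?thesis
            using G U by (simp add: vietoris_sub_def)
        qed
      qed (use \<F> C in auto)
    qed
  qed
qed

text \<open>Of two distinct closed sets, one has a point outside the other. Regularity separates
  that point from the other set by disjoint open \<open>U\<close> and \<open>V\<close>; a set
  meeting \<open>U\<close> is never contained in \<open>V\<close>.\<close>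

lemma Hausdorff_space_vietoris:
  assumes "regular_space K"
  shows "Hausdorff_space (vietoris K)"
proof -
  have sep: "\<exists>U V. openin (vietoris K) U \<and> openin (vietoris K) V \<and> F \<in> U \<and> G \<in> V \<and> disjnt U V"
    if FG: "F \<in> hyperset K" "G \<in> hyperset K" "\<not> F \<subseteq> G" for F G
  proof -
    obtain x where x: "x \<in> F" "x \<notin> G"
      using FG by blast
    moreover have "closedin K G" "x \<in> topspace K"
      using FG x closedin_subset[of K F] by (auto simp: hyperset_def)
    ultimately obtain U V where UV: "openin K U" "openin K V" "x \<in> U" "G \<subseteq> V" "disjnt U V"
      using assms unfolding regular_space_def by (metis DiffI)
    have "disjnt (vietoris_hit K U) (vietoris_sub K V)"
      using UV by (auto simp: disjnt_def vietoris_hit_def vietoris_sub_def)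
    moreover have "F \<in> vietoris_hit K U" "G \<in> vietoris_sub K V"
      using UV x FG by (auto simp: vietoris_hit_def vietoris_sub_def)
    ultimately show ?thesis
      using openin_vietoris_hit[OF UV(1)] openin_vietoris_sub[OF UV(2)] by blast
  qed
  show ?thesis
    unfolding Hausdorff_space_def topspace_vietoris
  proof (intro allI impI)
    fix F G assume FG: "F \<in> hyperset K \<and> G \<in> hyperset K \<and> F \<noteq> G"
    then consider "\<not> F \<subseteq> G" | "\<not> G \<subseteq> F"
      by blast
    then show "\<exists>U V. openin (vietoris K) U \<and> openin (vietoris K) V \<and> F \<in> U \<and> G \<in> V \<and> disjnt U V"
    proof cases
      case 1
      then show ?thesis
        using sep FG by blast
    next
      case 2
      then obtain U V where "openin (vietoris K) U" "openin (vietoris K) V" "G \<in> U" "F \<in> V" "disjnt U V"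
        using sep FG by metis
      then show ?thesis
        using disjnt_sym by blast
    qed
  qed
qed

lemma compactum_vietoris:
  assumes "compactum K"
  shows "compactum (vietoris K)"
  using assms compact_space_vietoris Hausdorff_space_vietoris compact_Hausdorff_imp_regular_space
  unfolding compactum_def by blast

lemma compactum_prod_topology:
  assumes "compactum X" "compactum Y"
  shows "compactum (prod_topology X Y)"
  using assms unfolding compactum_def
  by (simp add: Hausdorff_space_prod_topology compact_space_prod_topology)

section \<open>Continuity of union\<close>

text \<open>A union lies in \<open>U\<close> iff both sets do, and meets \<open>U\<close> iff at
  least one does. The subbasic preimages are therefore a product of open sets and a union of two
  open strips.\<close>

lemma continuous_map_vietoris_Un:
  "continuous_map (prod_topology (vietoris K) (vietoris K)) (vietoris K) (\<lambda>(F, G). F \<union> G)"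
proof (rule continuous_map_into_vietoris)
  show "(\<lambda>(F, G). F \<union> G) \<in> topspace (prod_topology (vietoris K) (vietoris K)) \<rightarrow> hyperset K"
    by (auto simp: hyperset_def)
next
  fix U assume U: "openin K U"
  have "{x \<in> topspace (prod_topology (vietoris K) (vietoris K)).
      (case x of (F, G) \<Rightarrow> F \<union> G) \<in> vietoris_sub K U} = vietoris_sub K U \<times> vietoris_sub K U"
    by (auto simp: vietoris_sub_def hyperset_def)
  then show "openin (prod_topology (vietoris K) (vietoris K))
      {x \<in> topspace (prod_topology (vietoris K) (vietoris K)).
        (case x of (F, G) \<Rightarrow> F \<union> G) \<in> vietoris_sub K U}"
    by (simp add: U openin_prod_Times_iff openin_vietoris_sub)
  have "{x \<in> topspace (prod_topology (vietoris K) (vietoris K)).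
      (case x of (F, G) \<Rightarrow> F \<union> G) \<in> vietoris_hit K U}
      = vietoris_hit K U \<times> hyperset K \<union> hyperset K \<times> vietoris_hit K U"
    by (auto simp: vietoris_hit_def hyperset_def)
  moreover have "openin (vietoris K) (hyperset K)"
    by (metis openin_topspace topspace_vietoris)
  ultimately show "openin (prod_topology (vietoris K) (vietoris K))
      {x \<in> topspace (prod_topology (vietoris K) (vietoris K)).
        (case x of (F, G) \<Rightarrow> F \<union> G) \<in> vietoris_hit K U}"
    by (simp add: U openin_prod_Times_iff openin_vietoris_hit openin_Un)
qed

section \<open>Strict ambiguous representations\<close>

text \<open>Enlarging a member of a box preserves the intersection conditions and may destroy only
  containment. Conversely, any \<open>G\<close> satisfying the intersection conditions contains a
  member of the box, so these conditions alone give a neighbourhood.\<close>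

lemma openin_vietoris_supersets:
  assumes "t1_space K" "openin (vietoris K) W"
  shows "openin (vietoris K) {F \<in> hyperset K. \<exists>F'\<in>W. F' \<subseteq> F}"
proof (rule openin_subopen[THEN iffD2], rule ballI)
  fix F assume "F \<in> {F \<in> hyperset K. \<exists>F'\<in>W. F' \<subseteq> F}"
  then obtain F' where F: "F \<in> hyperset K" "F' \<in> W" "F' \<subseteq> F"
    by blast
  obtain \<U> where \<U>: "finite \<U>" "\<And>U. U \<in> \<U> \<Longrightarrow> openin K U"
    "F' \<in> vietoris_box K \<U>" "vietoris_box K \<U> \<subseteq> W"
    by (rule openin_vietorisE[OF assms(2) F(2)]) blast
  have "F' \<noteq> {}" "F' \<subseteq> \<Union>\<U>"
    using \<U>(3) by (auto simp: vietoris_box_def hyperset_def)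
  \<comment> \<open>This keeps the intersection \<open>T\<close> inside the hyperspace and makes the
    finite selection below non-empty.\<close>
  then have "\<U> \<noteq> {}"
    by auto
  define T where "T = (\<Inter>U\<in>\<U>. vietoris_hit K U)"
  have "openin (vietoris K) T"
    unfolding T_def using \<U> \<open>\<U> \<noteq> {}\<close> by (intro openin_INT2 openin_vietoris_hit) auto
  moreover have "F \<in> T"
    using \<U>(3) F unfolding T_def vietoris_hit_def vietoris_box_def by blast
  moreover have "T \<subseteq> {F \<in> hyperset K. \<exists>F'\<in>W. F' \<subseteq> F}"
  proof
    fix G assume "G \<in> T"
    then have G: "G \<in> hyperset K" and "\<forall>U\<in>\<U>. \<exists>x. x \<in> G \<inter> U"
      using \<open>\<U> \<noteq> {}\<close> by (auto simp: T_def vietoris_hit_def)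
    \<comment> \<open>Finite subsets are closed, so one point of \<open>G\<close> in each \<open>U\<close> yields a member of the box.\<close>
    then obtain p where p: "\<And>U. U \<in> \<U> \<Longrightarrow> p U \<in> G \<inter> U"
      by metis
    have "p ` \<U> \<subseteq> topspace K"
      using p \<U>(2) openin_subset by blast
    then have "closedin K (p ` \<U>)"
      using assms(1) \<U>(1) by (simp add: t1_space_closedin_finite)
    then have "p ` \<U> \<in> vietoris_box K \<U>"
      using p \<open>\<U> \<noteq> {}\<close> by (auto simp: vietoris_box_def hyperset_def)
    then show "G \<in> {F \<in> hyperset K. \<exists>F'\<in>W. F' \<subseteq> F}"
      using \<U>(4) p G by (intro CollectI conjI bexI[of _ "p ` \<U>"] image_subsetI) blast+
  qed
  ultimately show "\<exists>T. openin (vietoris K) T \<and> F \<in> T \<and> T \<subseteq> {F \<in> hyperset K. \<exists>F'\<in>W. F' \<subseteq> F}"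
    by (intro exI[of _ T] conjI)
qed

text \<open>Dually, passing to a subset preserves only containment. Any \<open>G\<close> inside
  \<open>\<Union>\<U>\<close> lies below \<open>G \<union> F'\<close>, which is in the box because
  \<open>F'\<close> supplies the required intersections.\<close>

lemma openin_vietoris_subsets:
  assumes "openin (vietoris K) W"
  shows "openin (vietoris K) {F \<in> hyperset K. \<exists>F'\<in>W. F \<subseteq> F'}"
proof (rule openin_subopen[THEN iffD2], rule ballI)
  fix F assume "F \<in> {F \<in> hyperset K. \<exists>F'\<in>W. F \<subseteq> F'}"
  then obtain F' where F: "F \<in> hyperset K" "F' \<in> W" "F \<subseteq> F'"
    by blast
  obtain \<U> where \<U>: "finite \<U>" "\<And>U. U \<in> \<U> \<Longrightarrow> openin K U"
    "F' \<in> vietoris_box K \<U>" "vietoris_box K \<U> \<subseteq> W"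
    by (rule openin_vietorisE[OF assms F(2)]) blast
  have "openin (vietoris K) (vietoris_sub K (\<Union>\<U>))"
    using \<U> by (intro openin_vietoris_sub) auto
  moreover have "F \<in> vietoris_sub K (\<Union>\<U>)"
    using \<U>(3) F by (auto simp: vietoris_sub_def vietoris_box_def)
  moreover have "vietoris_sub K (\<Union>\<U>) \<subseteq> {F \<in> hyperset K. \<exists>F'\<in>W. F \<subseteq> F'}"
  proof
    fix G assume "G \<in> vietoris_sub K (\<Union>\<U>)"
    moreover from this have "G \<union> F' \<in> vietoris_box K \<U>"
      using \<U>(3) by (auto simp: vietoris_sub_def vietoris_box_def hyperset_def)
    ultimately show "G \<in> {F \<in> hyperset K. \<exists>F'\<in>W. F \<subseteq> F'}"
      using \<U>(4) by (auto simp: vietoris_sub_def)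
  qed
  ultimately show "\<exists>T. openin (vietoris K) T \<and> F \<in> T \<and> T \<subseteq> {F \<in> hyperset K. \<exists>F'\<in>W. F \<subseteq> F'}"
    by (intro exI[of _ "vietoris_sub K (\<Union>\<U>)"] conjI)
qed

lemma csamb_iff:
  "R \<in> csamb X Y \<longleftrightarrow>
     R \<in> hyperset (prod_topology (vietoris X) (vietoris Y)) \<and>
     hyperset X \<times> {topspace Y} \<subseteq> R \<and>
     (\<forall>A B A' B'. (A, B) \<in> R \<longrightarrow> A' \<in> hyperset X \<longrightarrow> B' \<in> hyperset Y \<longrightarrow>
        A' \<subseteq> A \<longrightarrow> B \<subseteq> B' \<longrightarrow> (A', B') \<in> R)"
  unfolding csamb_def strict_ambrep_def hyperset_def[of "prod_topology _ _"] by blast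

lemma closedin_csamb:
  assumes "compactum X" "compactum Y"
  shows "closedin (vietoris (prod_topology (vietoris X) (vietoris Y))) (csamb X Y)"
proof -
  define Z where "Z = prod_topology (vietoris X) (vietoris Y)"
  have Z: "compactum Z"
    unfolding Z_def using assms by (intro compactum_prod_topology compactum_vietoris)
  have topZ: "topspace Z = hyperset X \<times> hyperset Y"
    by (simp add: Z_def)
  have t1: "t1_space X"
    using assms(1) by (simp add: compactum_def Hausdorff_imp_t1_space)
  have reg: "regular_space Z"
    using Z by (simp add: compactum_def compact_Hausdorff_imp_regular_space)
  have "\<exists>T. openin (vietoris Z) T \<and> R \<in> T \<and> T \<subseteq> hyperset Z - csamb X Y"
    if R: "R \<in> hyperset Z - csamb X Y" for R
  proof -
    have clR: "closedin Z R" and RZ: "R \<in> hyperset Z"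
      using R by (auto simp: hyperset_def)
    have sub: "R \<subseteq> hyperset X \<times> hyperset Y"
      using clR closedin_subset topZ by metis
    have "\<not> (hyperset X \<times> {topspace Y} \<subseteq> R) \<or>
        (\<exists>A B A' B'. (A, B) \<in> R \<and> A' \<in> hyperset X \<and> B' \<in> hyperset Y \<and>
          A' \<subseteq> A \<and> B \<subseteq> B' \<and> (A', B') \<notin> R)"
      using RZ DiffD2[OF R] unfolding csamb_iff Z_def[symmetric] by metis
    then consider A where "A \<in> hyperset X" "(A, topspace Y) \<notin> R"
      | A B A' B' where "(A, B) \<in> R" "A' \<in> hyperset X" "B' \<in> hyperset Y"
        "A' \<subseteq> A" "B \<subseteq> B'" "(A', B') \<notin> R"
      by auto
    then show ?thesis
    proof cases
      case 1
      \<comment> \<open>Points of \<open>Z\<close> are closed, so avoiding the missing pair is an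
        open condition on closed sets; every set satisfying it lacks a pair that a representation
        must contain.\<close>
      have "openin Z (topspace Z - {(A, topspace Y)})"
        using Z by (simp add: compactum_def open_in_Hausdorff_delete)
      then have "openin (vietoris Z) (vietoris_sub Z (topspace Z - {(A, topspace Y)}))"
        by (rule openin_vietoris_sub)
      moreover have "R \<in> vietoris_sub Z (topspace Z - {(A, topspace Y)})"
        using RZ 1 sub topZ by (auto simp: vietoris_sub_def)
      moreover have "vietoris_sub Z (topspace Z - {(A, topspace Y)}) \<subseteq> hyperset Z - csamb X Y"
      proof
        fix S assume S: "S \<in> vietoris_sub Z (topspace Z - {(A, topspace Y)})"
        then have "(A, topspace Y) \<notin> S"
          by (auto simp: vietoris_sub_def)
        then have "S \<notin> csamb X Y"
          unfolding csamb_iff using 1(1) by blast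
        then show "S \<in> hyperset Z - csamb X Y"
          using S by (simp add: vietoris_sub_def)
      qed
      ultimately show ?thesis by blast
    next
      case 2
      then have "(A', B') \<in> topspace Z - R"
        using topZ by blast
      then obtain V N where VN: "openin Z V" "openin Z N" "(A', B') \<in> V" "R \<subseteq> N" "disjnt V N"
        using reg clR unfolding regular_space_def by metis
      obtain V1 V2 where V12: "openin (vietoris X) V1" "openin (vietoris Y) V2"
        "A' \<in> V1" "B' \<in> V2" "V1 \<times> V2 \<subseteq> V"
        using VN(1,3) unfolding Z_def openin_prod_topology_alt by metis
      \<comment> \<open>Monotonicity shrinks the first component and enlarges the second, so the
        factors are saturated in opposite directions. Passing to the rectangle
        \<open>V1 \<times> V2\<close> allows this factor by factor.\<close>
      define W where "W = {F \<in> hyperset X. \<exists>F'\<in>V1. F' \<subseteq> F} \<times> {F \<in> hyperset Y. \<exists>F'\<in>V2. F \<subseteq> F'}"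
      have "openin Z W"
        unfolding W_def Z_def openin_prod_Times_iff
        using openin_vietoris_supersets[OF t1 V12(1)] openin_vietoris_subsets[OF V12(2)] by blast
      then have "openin (vietoris Z) (vietoris_sub Z N \<inter> vietoris_hit Z W)"
        using VN(2) by (intro openin_Int openin_vietoris_sub openin_vietoris_hit)
      moreover have "(A, B) \<in> W"
        using 2 V12 sub by (auto simp: W_def)
      then have "R \<in> vietoris_sub Z N \<inter> vietoris_hit Z W"
        using RZ VN(4) 2(1) by (auto simp: vietoris_sub_def vietoris_hit_def)
      moreover have "vietoris_sub Z N \<inter> vietoris_hit Z W \<subseteq> hyperset Z - csamb X Y"
      proof
        fix S assume S: "S \<in> vietoris_sub Z N \<inter> vietoris_hit Z W"
        then obtain A1 B1 A2 B2 where S1: "(A1, B1) \<in> S" "A2 \<in> V1" "B2 \<in> V2" "A2 \<subseteq> A1" "B1 \<subseteq> B2"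
          by (auto simp: vietoris_hit_def W_def)
        have "A2 \<in> hyperset X" "B2 \<in> hyperset Y"
          using S1 openin_subset[OF V12(1)] openin_subset[OF V12(2)] by auto
        \<comment> \<open>Monotonicity would force this pair into \<open>S\<close>, but it lies in
          \<open>V\<close>, which is disjoint from \<open>N\<close> and hence from
          \<open>S\<close>.\<close>
        moreover have "(A2, B2) \<in> V"
          using S1(2,3) V12(5) by blast
        then have "(A2, B2) \<notin> N"
          using VN(5) by (auto simp: disjnt_iff)
        then have "(A2, B2) \<notin> S"
          using S by (auto simp: vietoris_sub_def)
        ultimately have "S \<notin> csamb X Y"
          unfolding csamb_iff using S1(1,4,5) by metis
        then show "S \<in> hyperset Z - csamb X Y"
          using S by (simp add: vietoris_sub_def)
      qed
      ultimately show ?thesis by blast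
    qed
  qed
  then have "openin (vietoris Z) (hyperset Z - csamb X Y)"
    by (intro openin_subopen[THEN iffD2] ballI)
  moreover have "csamb X Y \<subseteq> hyperset Z"
    by (auto simp: csamb_def Z_def)
  ultimately show ?thesis
    unfolding Z_def closedin_def by simp
qed

section \<open>Union as the join of representations\<close>

lemma csamb_Un:
  assumes "R \<in> csamb X Y" "S \<in> csamb X Y"
  shows "R \<union> S \<in> csamb X Y"
  unfolding csamb_iff
proof (intro conjI allI impI)
  show "R \<union> S \<in> hyperset (prod_topology (vietoris X) (vietoris Y))"
    using assms by (auto simp: csamb_def hyperset_def)
  show "hyperset X \<times> {topspace Y} \<subseteq> R \<union> S"
    using assms(1) unfolding csamb_iff by (simp add: le_supI1)
  show "(A', B') \<in> R \<union> S"
    if "(A, B) \<in> R \<union> S" "A' \<in> hyperset X" "B' \<in> hyperset Y" "A' \<subseteq> A" "B \<subseteq> B'" for A B A' B'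
    using that assms unfolding csamb_iff by (metis Un_iff)
qed

lemma least_csamb_Un:
  assumes "R \<in> csamb X Y" "S \<in> csamb X Y"
  shows "least (csamb_order X Y) (R \<union> S) (Upper (csamb_order X Y) {R, S})"
  using assms csamb_Un[OF assms] by (auto simp: least_def Upper_def csamb_order_def)

lemma upper_semilattice_csamb: "upper_semilattice (csamb_order X Y)"
proof
  show "\<exists>s. least (csamb_order X Y) s (Upper (csamb_order X Y) {R, S})"
    if "R \<in> carrier (csamb_order X Y)" "S \<in> carrier (csamb_order X Y)" for R S
    using that least_csamb_Un by (fastforce simp: csamb_order_def)
qed (auto simp: csamb_order_def)

lemma join_csamb_order:
  assumes "R \<in> csamb X Y" "S \<in> csamb X Y"
  shows "R \<squnion>\<^bsub>csamb_order X Y\<^esub> S = R \<union> S"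
  unfolding join_def sup_def
proof (rule some_equality)
  show "least (csamb_order X Y) (R \<union> S) (Upper (csamb_order X Y) {R, S})"
    by (rule least_csamb_Un[OF assms])
  \<comment> \<open>The join is a \<open>SOME\<close> choice among least upper bounds, so it is
    determined only once uniqueness is shown; antisymmetry of inclusion gives it.\<close>
  then show "T = R \<union> S" if "least (csamb_order X Y) T (Upper (csamb_order X Y) {R, S})" for T
    using that unfolding least_def by (simp add: csamb_order_def subset_antisym)
qed

section \<open>The compact Lawson semilattice\<close>

theorem proposition2p27:
  fixes X :: "'a topology" and Y :: "'b topology"
  assumes "compactum X" and "compactum Y"
  shows "compact_space (csamb_topology X Y) \<and>
         Lawson_upper_semilattice (csamb_order X Y) (csamb_topology X Y) \<and>
         (\<forall>R\<in>csamb X Y. \<forall>S\<in>csamb X Y. R \<squnion>\<^bsub>csamb_order X Y\<^esub> S = R \<union> S)"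
proof (intro conjI ballI)
  define Z where "Z = prod_topology (vietoris X) (vietoris Y)"
  define T where "T = csamb_topology X Y"
  have T: "T = subtopology (vietoris Z) (csamb X Y)"
    by (simp add: T_def Z_def csamb_topology_def)
  have expZ: "compactum (vietoris Z)"
    unfolding Z_def using assms by (intro compactum_prod_topology compactum_vietoris)
  have topT: "topspace T = csamb X Y"
    by (simp add: T_def)
  show "compact_space (csamb_topology X Y)"
    using closedin_csamb[OF assms] expZ
    unfolding csamb_topology_def compactum_def Z_def
    by (blast intro: compact_space_subtopology closedin_compact_space)
  have "continuous_map (prod_topology T T) (vietoris Z) (\<lambda>(R, S). R \<union> S)"
    unfolding T subtopology_Times[symmetric]
    by (rule continuous_map_from_subtopology[OF continuous_map_vietoris_Un])
  then have "continuous_map (prod_topology T T) T (\<lambda>(R, S). R \<union> S)"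
    \<comment> \<open>The third occurrence of \<open>T\<close> is the codomain. Only it is unfolded,
      which leaves the requirement that unions stay in \<open>csamb X Y\<close>.\<close>
    by (subst (3) T) (auto simp: continuous_map_in_subtopology topT csamb_Un)
  \<comment> \<open>The join is known to be the union only on \<open>csamb X Y\<close>; agreement on
    the topological space is enough to transfer continuity.\<close>
  then have "continuous_map (prod_topology T T) T (\<lambda>(R, S). R \<squnion>\<^bsub>csamb_order X Y\<^esub> S)"
    by (rule continuous_map_eq) (auto simp: topT join_csamb_order)
  then have "topological_upper_semilattice (csamb_order X Y) T"
    unfolding topological_upper_semilattice_def
  proof (intro conjI)
    show "carrier (csamb_order X Y) = topspace T"
      by (simp add: topT csamb_order_def)
    show "Hausdorff_space T"
      using expZ by (simp add: T compactum_def Hausdorff_space_subtopology)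
  qed (rule upper_semilattice_csamb)
  moreover have "neighbourhood_base_at R
      (\<lambda>V. openin T V \<and> upper_subsemilattice (csamb_order X Y) V) T" for R
    unfolding neighbourhood_base_at_def
  proof (intro allI impI)
    fix W assume "openin T W \<and> R \<in> W"
    then obtain W' where W': "openin (vietoris Z) W'" "W = W' \<inter> csamb X Y" "R \<in> W'" "R \<in> csamb X Y"
      unfolding T openin_subtopology by blast
    obtain \<U> where \<U>: "finite \<U>" "\<And>U. U \<in> \<U> \<Longrightarrow> openin Z U"
      "R \<in> vietoris_box Z \<U>" "vietoris_box Z \<U> \<subseteq> W'"
      by (rule openin_vietorisE[OF W'(1,3)]) blast
    define V where "V = vietoris_box Z \<U> \<inter> csamb X Y"
    have "openin T V"
      unfolding T V_def using \<U> by (simp add: openin_subtopology_Int openin_vietoris_box)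
    moreover have "upper_subsemilattice (csamb_order X Y) V"
    proof -
      have "R \<union> S \<in> vietoris_box Z \<U>" if "R \<in> vietoris_box Z \<U>" "S \<in> vietoris_box Z \<U>" for R S
        using that by (auto simp: vietoris_box_def hyperset_def)
      then show ?thesis
        by (auto simp: upper_subsemilattice_def V_def join_csamb_order csamb_Un)
          (simp add: csamb_order_def)
    qed
    \<comment> \<open>Since \<open>V\<close> is open, it serves both as the neighbourhood and as the
      open set inside it.\<close>
    ultimately show "\<exists>U V. openin T U \<and> (openin T V \<and> upper_subsemilattice (csamb_order X Y) V) \<and>
        R \<in> U \<and> U \<subseteq> V \<and> V \<subseteq> W"
      using \<U>(3,4) W' by (intro exI[of _ V]) (auto simp: V_def)
  qed
  ultimately show "Lawson_upper_semilattice (csamb_order X Y) (csamb_topology X Y)"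
    unfolding Lawson_upper_semilattice_def T_def by blast
qed (rule join_csamb_order)

end
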